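(* Let $k \geq 4$ be an even integer. Every connected $(k,2)$-bipartite graph is antimagic.
   Context: All graphs are finite, simple and undirected. A bipartite graph $G=(X\cup Y,E)$ is a $(k,k')$-bipartite graph (biregular bipartite graph) if every vertex of $X$ has degree $k$ and every vertex of $Y$ has degree $k'$. For a graph $G=(V,E)$ with $m=|E|$, an antimagic labelling is a bijection $f:E\to\{1,2,\ldots,m\}$ such that the vertex sums $\sigma(u)=\sum_{v: uv\in E} f(uv)$, $u\in V$, are pairwise distinct. A graph is antimagic if it admits an antimagic labelling. *)

theory Defs
  imports Main
begin

text \<open>A graph is given by a vertex set \<open>V\<close> and a set \<open>E\<close> of two-element subsets of \<open>V\<close>,
  so that an edge labelling is a function on unordered pairs.\<close>

definition simple_graph :: "'a set \<Rightarrow> 'a set set \<Rightarrow> bool" where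
  "simple_graph V E \<longleftrightarrow> finite V \<and> (\<forall>e\<in>E. e \<subseteq> V \<and> card e = 2)"

definition degree :: "'a set set \<Rightarrow> 'a \<Rightarrow> nat" where
  "degree E u = card {v. {u, v} \<in> E}"

definition connected_graph :: "'a set \<Rightarrow> 'a set set \<Rightarrow> bool" where
  "connected_graph V E \<longleftrightarrow> V \<noteq> {} \<and> (\<forall>u\<in>V. \<forall>v\<in>V. (u, v) \<in> {(x, y). {x, y} \<in> E}\<^sup>*)"

definition bipartite_graph :: "'a set \<Rightarrow> 'a set \<Rightarrow> 'a set set \<Rightarrow> bool" where
  "bipartite_graph X Y E \<longleftrightarrow>
     simple_graph (X \<union> Y) E \<and> X \<inter> Y = {} \<and> (\<forall>e\<in>E. \<exists>x\<in>X. \<exists>y\<in>Y. e = {x, y})"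

definition biregular_bipartite :: "nat \<Rightarrow> nat \<Rightarrow> 'a set \<Rightarrow> 'a set \<Rightarrow> 'a set set \<Rightarrow> bool" where
  "biregular_bipartite k k' X Y E \<longleftrightarrow>
     bipartite_graph X Y E \<and> (\<forall>x\<in>X. degree E x = k) \<and> (\<forall>y\<in>Y. degree E y = k')"

definition vertex_sum :: "'a set set \<Rightarrow> ('a set \<Rightarrow> nat) \<Rightarrow> 'a \<Rightarrow> nat" where
  "vertex_sum E f u = (\<Sum>v | {u, v} \<in> E. f {u, v})"

definition antimagic_labelling :: "'a set \<Rightarrow> 'a set set \<Rightarrow> ('a set \<Rightarrow> nat) \<Rightarrow> bool" where
  "antimagic_labelling V E f \<longleftrightarrow> bij_betw f E {1..card E} \<and> inj_on (vertex_sum E f) V"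

definition antimagic :: "'a set \<Rightarrow> 'a set set \<Rightarrow> bool" where
  "antimagic V E \<longleftrightarrow> (\<exists>f. antimagic_labelling V E f)"

end

theory Submission
  imports Defs
begin

text \<open>
  Each vertex \<open>y\<close> of \<open>Y\<close> is an edge of a connected \<open>k\<close>-regular multigraph on \<open>X\<close>; both of its
  halves receive a label. Fix a root and let the levels be the distance classes from it. Every
  vertex \<open>v\<close> other than the root has a special edge to the previous level. The levels are treated
  from the farthest to the nearest, each using the next block of labels: first the edges inside the
  level, then the remaining upward edges with all lower halves labelled below all upper halves,
  and last the special edges. The lower half of the special edge of \<open>v\<close> contributes to \<open>v\<close> but to
  no other vertex of the level, so assigning the special labels in the order of the partial sums
  makes the sums within the level distinct, and the choice which half of the special edge gets
  which label makes each of these sums even. All sums at \<open>Y\<close> are kept odd and distinct. Passing to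
  the next level raises every label at a vertex, hence raises the sums, and for even \<open>k \<ge> 4\<close> the
  root sum exceeds every other sum, so that its parity does not matter.
\<close>

subsection \<open>Labellings of half-edges\<close>

text \<open>The ranks are the positions in a list of \<open>L\<close> sorted by \<open>w\<close>.
  Ties are broken arbitrarily, so \<open>w\<close> is only weakly monotone in the rank.\<close>

lemma ex_monotone_ranking:
  fixes w :: "'a \<Rightarrow> nat"
  assumes "finite L"
  shows "\<exists>j. bij_betw j L {..<card L} \<and> (\<forall>u\<in>L. \<forall>v\<in>L. j u < j v \<longrightarrow> w u \<le> w v)"
proof -
  obtain ys where "set ys = L" "distinct ys"
    using finite_distinct_list[OF assms] by blast
  define xs where "xs = sort_key w ys"
  have xs: "set xs = L" "distinct xs" "sorted (map w xs)"
    using \<open>set ys = L\<close> \<open>distinct ys\<close> by (simp_all add: xs_def)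
  have len: "length xs = card L"
    using distinct_card[OF xs(2)] xs(1) by simp
  have bij: "bij_betw ((!) xs) {..<card L} L"
    by (rule bij_betw_nth[OF xs(2)]) (simp_all add: xs(1) len)
  define j where "j = inv_into {..<card L} ((!) xs)"
  have j: "bij_betw j L {..<card L}"
    unfolding j_def using bij by (rule bij_betw_inv_into)
  have nth: "xs ! j v = v" if "v \<in> L" for v
    using bij_betw_inv_into_right[OF bij that] by (simp add: j_def)
  have "w u \<le> w v" if "u \<in> L" "v \<in> L" "j u < j v" for u v
  proof -
    have "j v < length xs"
      using j that(2) len by (auto dest: bij_betwE)
    then have "map w xs ! j u \<le> map w xs ! j v"
      using that(3) xs(3) by (intro sorted_nth_mono) auto
    then show ?thesis
      using nth that \<open>j v < length xs\<close> by simp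
  qed
  with j show ?thesis by blast
qed

text \<open>The boolean selects the half of an edge. With both halves under one function, a single
  injectivity statement covers all labels.\<close>

definition half_label :: "('b \<Rightarrow> nat) \<Rightarrow> ('b \<Rightarrow> nat) \<Rightarrow> 'b \<times> bool \<Rightarrow> nat" where
  "half_label a b = (\<lambda>(y, s). if s then a y else b y)"

lemma half_label_simps [simp]:
  "half_label a b (y, True) = a y" "half_label a b (y, False) = b y"
  by (simp_all add: half_label_def)

text \<open>Inclusion suffices for the image: a finite \<open>B\<close> has
  \<open>2 * card B\<close> halves, so injective labels fill the whole block. The sum
  \<open>a y + b y\<close> is the future vertex sum at \<open>y\<close>, which has degree
  two.\<close>

definition odd_labelling :: "('b \<Rightarrow> nat) \<Rightarrow> ('b \<Rightarrow> nat) \<Rightarrow> nat \<Rightarrow> 'b set \<Rightarrow> bool" where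
  "odd_labelling a b m B \<longleftrightarrow> inj_on (half_label a b) (B \<times> UNIV) \<and>
     half_label a b ` (B \<times> UNIV) \<subseteq> {m<..m + 2 * card B} \<and>
     inj_on (\<lambda>y. a y + b y) B \<and> (\<forall>y\<in>B. odd (a y + b y))"

lemma odd_labellingI:
  assumes "\<And>y. y \<in> B \<Longrightarrow> m < a y \<and> a y \<le> m + 2 * card B \<and> m < b y \<and> b y \<le> m + 2 * card B"
    and "\<And>y z. \<lbrakk>y \<in> B; z \<in> B; y \<noteq> z\<rbrakk> \<Longrightarrow> a y \<noteq> a z \<and> b y \<noteq> b z \<and> a y + b y \<noteq> a z + b z"
    and "\<And>y z. \<lbrakk>y \<in> B; z \<in> B\<rbrakk> \<Longrightarrow> a y \<noteq> b z"
    and "\<And>y. y \<in> B \<Longrightarrow> odd (a y + b y)"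
  shows "odd_labelling a b m B"
proof -
  have "inj_on (half_label a b) (B \<times> UNIV)"
  proof (rule inj_onI, clarsimp)
    fix y s z t
    assume "y \<in> B" "z \<in> B" "half_label a b (y, s) = half_label a b (z, t)"
    then show "y = z \<and> s = t"
      using assms(2)[of y z] assms(3)[of y z] assms(3)[of z y]
      by (cases s; cases t) (simp_all, metis+)
  qed
  moreover have "half_label a b ` (B \<times> UNIV) \<subseteq> {m<..m + 2 * card B}"
    using assms(1) by (auto simp: half_label_def)
  moreover have "inj_on (\<lambda>y. a y + b y) B"
    using assms(2) by (meson inj_onI)
  ultimately show ?thesis
    using assms(4) by (simp add: odd_labelling_def)
qed

lemma odd_labelling_bounds:
  assumes "odd_labelling a b m B" "y \<in> B"
  shows "m < a y" "a y \<le> m + 2 * card B" "m < b y" "b y \<le> m + 2 * card B"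
proof -
  have "half_label a b ` (B \<times> UNIV) \<subseteq> {m<..m + 2 * card B}"
    using assms(1) by (simp add: odd_labelling_def)
  then have "half_label a b (y, s) \<in> {m<..m + 2 * card B}" for s
    using assms(2) by blast
  from this[of True] this[of False]
  show "m < a y" "a y \<le> m + 2 * card B" "m < b y" "b y \<le> m + 2 * card B"
    by auto
qed

lemma odd_labelling_distinct:
  assumes "odd_labelling a b m B" "y \<in> B" "z \<in> B"
  shows "y \<noteq> z \<Longrightarrow> a y \<noteq> a z" "y \<noteq> z \<Longrightarrow> b y \<noteq> b z" "a y \<noteq> b z"
    "y \<noteq> z \<Longrightarrow> a y + b y \<noteq> a z + b z" "odd (a y + b y)"
proof -
  have inj: "inj_on (half_label a b) (B \<times> UNIV)"
    using assms(1) by (simp add: odd_labelling_def)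
  show "y \<noteq> z \<Longrightarrow> a y \<noteq> a z"
    using inj_onD[OF inj, of "(y, True)" "(z, True)"] assms by auto
  show "y \<noteq> z \<Longrightarrow> b y \<noteq> b z"
    using inj_onD[OF inj, of "(y, False)" "(z, False)"] assms by auto
  show "a y \<noteq> b z"
    using inj_onD[OF inj, of "(y, True)" "(z, False)"] assms by auto
  show "y \<noteq> z \<Longrightarrow> a y + b y \<noteq> a z + b z" "odd (a y + b y)"
    using assms by (auto simp: odd_labelling_def dest: inj_onD)
qed

lemma odd_labelling_cong:
  assumes "odd_labelling a b m B" "\<And>y. y \<in> B \<Longrightarrow> a' y = a y \<and> b' y = b y"
  shows "odd_labelling a' b' m B"
  by (rule odd_labellingI) (use assms odd_labelling_bounds[OF assms(1)] odd_labelling_distinct[OF assms(1)] in auto)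

text \<open>Every label on \<open>A\<close> lies below every label on \<open>B\<close>, so sums
  across the two sets differ as well.\<close>

lemma odd_labelling_Un:
  assumes "odd_labelling a b m A" "odd_labelling a b (m + 2 * card A) B"
    and "finite A" "finite B" "A \<inter> B = {}"
  shows "odd_labelling a b m (A \<union> B)"
proof -
  have card: "card (A \<union> B) = card A + card B"
    using assms by (simp add: card_Un_disjoint)
  note A = odd_labelling_bounds[OF assms(1)] odd_labelling_distinct[OF assms(1)]
  note B = odd_labelling_bounds[OF assms(2)] odd_labelling_distinct[OF assms(2)]
  have less: "a y < a z" "b y < b z" "a y < b z" "b y < a z" if "y \<in> A" "z \<in> B" for y z
    using A(1-4)[OF that(1)] B(1-4)[OF that(2)] by linarith+
  show ?thesis
  proof (rule odd_labellingI)
    fix y assume "y \<in> A \<union> B"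
    then show "m < a y \<and> a y \<le> m + 2 * card (A \<union> B) \<and> m < b y \<and> b y \<le> m + 2 * card (A \<union> B)"
      using A(1-4)[of y] B(1-4)[of y] by (auto simp: card)
    show "odd (a y + b y)"
      using \<open>y \<in> A \<union> B\<close> A(9) B(9) by blast
  next
    fix y z assume "y \<in> A \<union> B" "z \<in> A \<union> B"
    then show "a y \<noteq> b z"
      using A(7)[of y z] B(7)[of y z] less(3)[of y z] less(4)[of z y] by fastforce
  next
    fix y z assume *: "y \<in> A \<union> B" "z \<in> A \<union> B" "y \<noteq> z"
    consider "y \<in> A" "z \<in> A" | "y \<in> B" "z \<in> B" | "y \<in> A" "z \<in> B" | "y \<in> B" "z \<in> A"
      using * by blast
    then show "a y \<noteq> a z \<and> b y \<noteq> b z \<and> a y + b y \<noteq> a z + b z"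
    proof cases
      case 1 then show ?thesis using A(5,6,8) *(3) by blast
    next
      case 2 then show ?thesis using B(5,6,8) *(3) by blast
    next
      case 3 then show ?thesis using less(1,2)[of y z] by fastforce
    next
      case 4 then show ?thesis using less(1,2)[of z y] by fastforce
    qed
  qed
qed

section \<open>Label blocks for the edges of a single level\<close>

lemma odd_labelling_consecutive_pairs:
  assumes "bij_betw i W {..<card W}"
    and "\<And>y. y \<in> W \<Longrightarrow> a y = m + 2 * i y + 1 \<and> b y = m + 2 * i y + 2"
  shows "odd_labelling a b m W"
proof (rule odd_labellingI)
  have i: "i y < card W" if "y \<in> W" for y
    using assms(1) that by (auto dest: bij_betwE)
  have inj: "i y \<noteq> i z" if "y \<in> W" "z \<in> W" "y \<noteq> z" for y z
    using assms(1) that by (meson bij_betw_imp_inj_on inj_onD)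
  fix y assume y: "y \<in> W"
  show "m < a y \<and> a y \<le> m + 2 * card W \<and> m < b y \<and> b y \<le> m + 2 * card W"
    using assms(2)[OF y] i[OF y] by linarith
  show "odd (a y + b y)"
    using assms(2)[OF y] by simp
  fix z assume z: "z \<in> W"
  show "a y \<noteq> b z"
    using assms(2)[OF y] assms(2)[OF z] by presburger
  show "a y \<noteq> a z \<and> b y \<noteq> b z \<and> a y + b y \<noteq> a z + b z" if "y \<noteq> z"
    using assms(2)[OF y] assms(2)[OF z] inj[OF y z that] by linarith
qed

text \<open>
  Offsets for \<open>q\<close> ordinary upward edges followed by the special ones. The \<open>i\<close>-th ordinary edge
  gets \<open>i + 1\<close> and \<open>split_high q i\<close>, the \<open>i\<close>-th special edge \<open>pair_low q i\<close> and \<open>pair_high q i\<close>. For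
  even \<open>q\<close> the sum \<open>(i + 1) + (q + i + 1)\<close> would be even, so the upper labels are shifted by one; the
  first special edge absorbs the skipped label \<open>q + 1\<close>.
\<close>

definition split_high :: "nat \<Rightarrow> nat \<Rightarrow> nat" where
  "split_high q i = q + (if even q then 1 else 0) + i + 1"

definition pair_high :: "nat \<Rightarrow> nat \<Rightarrow> nat" where
  "pair_high q i = 2 * q + 2 * i + 2"

definition pair_low :: "nat \<Rightarrow> nat \<Rightarrow> nat" where
  "pair_low q i = (if even q \<and> i = 0 then q + 1 else 2 * q + 2 * i + 1)"

lemmas split_label_defs = split_high_def pair_high_def pair_low_def

lemma odd_pair_low: "odd (pair_low q i)"
  by (auto simp: pair_low_def)

lemma even_pair_high: "even (pair_high q i)"
  by (auto simp: pair_high_def)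

lemma pair_low_less_high: "pair_low q i < pair_high q i"
  by (auto simp: pair_low_def pair_high_def)

lemma pair_high_less_low: "i < j \<Longrightarrow> pair_high q i < pair_low q j"
  by (auto simp: pair_low_def pair_high_def)

text \<open>The tight case is even \<open>q\<close>: the upper offsets then run from
  \<open>q + 2\<close> to \<open>2 * q + 1\<close>, which leaves \<open>q + 1\<close> to the first
  special edge and stays below \<open>2 * q + 2\<close>, the least value of
  \<open>pair_high\<close>.\<close>

lemma split_label_order:
  assumes "i < q"
  shows "i + 1 < pair_low q j \<and> i + 1 < pair_high q j \<and> split_high q i \<noteq> pair_low q j \<and>
    split_high q i < pair_high q j \<and> i + 1 + split_high q i < pair_low q j + pair_high q j"
  using assms by (auto simp: split_label_defs)

text \<open>A special edge may receive its two labels in either order: its sum stays the same, and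
  both labels of an earlier special edge lie below both labels of a later one. A nonempty
  \<open>P\<close> calls for a nonempty \<open>S\<close>, because for even \<open>card P\<close> the
  upper offsets reach \<open>2 * card P + 1\<close>.\<close>

lemma odd_labelling_split:
  assumes P: "bij_betw i P {..<card P}" and S: "bij_betw j S {..<card S}"
    and fin: "finite P" "finite S" and disj: "P \<inter> S = {}" and S_ne: "P \<noteq> {} \<Longrightarrow> S \<noteq> {}"
    and onP: "\<And>y. y \<in> P \<Longrightarrow> a y = m + i y + 1 \<and> b y = m + split_high (card P) (i y)"
    and onS: "\<And>y. y \<in> S \<Longrightarrow>
      a y = m + pair_low (card P) (j y) \<and> b y = m + pair_high (card P) (j y) \<or>
      a y = m + pair_high (card P) (j y) \<and> b y = m + pair_low (card P) (j y)"
  shows "odd_labelling a b m (P \<union> S)"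
proof (rule odd_labellingI)
  have card: "card (P \<union> S) = card P + card S"
    using fin disj by (simp add: card_Un_disjoint)
  have i: "i y < card P" if "y \<in> P" for y
    using P that by (auto dest: bij_betwE)
  have j: "j y < card S" if "y \<in> S" for y
    using S that by (auto dest: bij_betwE)
  have i_inj: "i y \<noteq> i z" if "y \<in> P" "z \<in> P" "y \<noteq> z" for y z
    using P that by (meson bij_betw_imp_inj_on inj_onD)
  have j_inj: "j y \<noteq> j z" if "y \<in> S" "z \<in> S" "y \<noteq> z" for y z
    using S that by (meson bij_betw_imp_inj_on inj_onD)
  have pos: "0 < card S" if "y \<in> P" for y
    using S_ne fin that by (auto simp: card_gt_0_iff)
  fix y assume y: "y \<in> P \<union> S"
  show "m < a y \<and> a y \<le> m + 2 * card (P \<union> S) \<and> m < b y \<and> b y \<le> m + 2 * card (P \<union> S)"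
  proof (cases "y \<in> P")
    case True
    then show ?thesis
      using onP[OF True] i[OF True] pos[OF True] by (auto simp: card split_high_def)
  next
    case False
    then have "y \<in> S" using y by blast
    then show ?thesis
      using onS[of y] j[of y] by (auto simp: card pair_low_def pair_high_def)
  qed
  show "odd (a y + b y)"
  proof (cases "y \<in> P")
    case True
    then show ?thesis using onP[OF True] by (auto simp: split_high_def)
  next
    case False
    then have "y \<in> S" using y by blast
    then show ?thesis
      using onS[of y] odd_pair_low[of "card P" "j y"] even_pair_high[of "card P" "j y"] by auto
  qed
  fix z assume z: "z \<in> P \<union> S"
  consider "y \<in> P" "z \<in> P" | "y \<in> P" "z \<in> S" | "y \<in> S" "z \<in> P" | "y \<in> S" "z \<in> S"
    using y z by blast
  note cases = this
  let ?q = "card P"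
  have sum: "a y + b y = 2 * m + pair_low ?q (j y) + pair_high ?q (j y)" if "y \<in> S" for y
    using onS[OF that] by linarith
  have ai: "a y = m + (i y + 1)" "b y = m + split_high ?q (i y)" if "y \<in> P" for y
    using onP[OF that] by simp_all
  have aS: "a y = m + pair_low ?q (j y) \<and> b y = m + pair_high ?q (j y) \<or>
      a y = m + pair_high ?q (j y) \<and> b y = m + pair_low ?q (j y)" if "y \<in> S" for y
    using onS[OF that] .
  have PS: "a y \<noteq> a z" "b y \<noteq> b z" "a y \<noteq> b z" "a z \<noteq> b y" "a y + b y < a z + b z"
    if "y \<in> P" "z \<in> S" for y z
    using aS[OF that(2)] ai[OF that(1)] sum[OF that(2)] split_label_order[OF i[OF that(1)], of "j z"]
    by auto
  have PP: "a y \<noteq> b z" if "y \<in> P" "z \<in> P" for y z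
    using ai[OF that(1)] ai[OF that(2)] i[OF that(1)] by (auto simp: split_high_def)
  have SS: "a y < a z \<and> b y < b z \<and> a y < b z \<and> b y < a z"
    if "y \<in> S" "z \<in> S" "j y < j z" for y z
    using aS[OF that(1)] aS[OF that(2)] pair_high_less_low[OF that(3), of ?q]
      pair_low_less_high[of ?q "j y"] pair_low_less_high[of ?q "j z"] by (elim disjE) simp_all
  have SS': "a y \<noteq> b z" if yz: "y \<in> S" "z \<in> S" for y z
  proof -
    consider "y = z" | "j y < j z" | "j z < j y"
      using j_inj[of y z] yz by (meson linorder_neqE_nat)
    then show ?thesis
    proof cases
      case 1
      then show ?thesis
        using aS[OF yz(1)] pair_low_less_high[of ?q "j y"] by auto
    next
      case 2
      then show ?thesis using SS[of y z] yz by simp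
    next
      case 3
      then show ?thesis using SS[of z y] yz by simp
    qed
  qed
  from cases show "a y \<noteq> b z"
  proof cases
    case 1 then show ?thesis by (rule PP)
  next
    case 2 then show ?thesis by (rule PS)
  next
    case 3 then show ?thesis using PS(4)[of z y] by simp
  next
    case 4 then show ?thesis by (rule SS')
  qed
  assume ne: "y \<noteq> z"
  from cases show "a y \<noteq> a z \<and> b y \<noteq> b z \<and> a y + b y \<noteq> a z + b z"
  proof cases
    case 1 then show ?thesis using ai[of y] ai[of z] i_inj[of y z] ne by (simp add: split_high_def)
  next
    case 2 then show ?thesis using PS[of y z] by simp
  next
    case 3 then show ?thesis using PS[of z y] by simp
  next
    case 4
    then consider "j y < j z" | "j z < j y" using j_inj ne by (meson linorder_neqE_nat)
    then show ?thesis using SS[of y z] SS[of z y] 4 by cases auto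
  qed
qed

text \<open>Here \<open>p\<close> counts the vertices at distance one from the root,
  \<open>q\<close> the ordinary edges between them and the root, and \<open>N\<close> all edges. The
  bound will push the root sum up to at least \<open>4 * N\<close>.\<close>

lemma root_sum_bound:
  fixes k p q c N :: nat
  assumes "4 \<le> k" "0 < p" "p + q = k" "c + q + 2 * p = 2 * N" "k * (1 + p) \<le> 2 * N"
  shows "2 * N + 1 \<le> (k - 1) * Suc c"
proof -
  \<comment> \<open>With \<open>c\<close> eliminated and the factor 3 in place of
    \<open>k - 1\<close>, the claim reads 3k + 3p \<le> 4N + 2. The bound on k(1 + p) reduces this
    to 3p \<le> k(2p - 1) + 2.\<close>
  have "int k * (2 * int p - 1) \<ge> 4 * (2 * int p - 1)"
    using assms by (intro mult_right_mono) auto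
  moreover have "int k * (1 + int p) \<le> 2 * int N"
    using assms(5) by (metis of_nat_1 of_nat_add of_nat_le_iff of_nat_mult of_nat_numeral)
  ultimately have "2 * N + 1 \<le> 3 * Suc c"
    using assms(1-4) by (simp add: algebra_simps)
  also have "\<dots> \<le> (k - 1) * Suc c"
    using assms(1) by (intro mult_right_mono) auto
  finally show ?thesis .
qed

subsection \<open>Labelling level by level\<close>

text \<open>
  Here \<open>Y\<close> is the edge set of a multigraph on \<open>X\<close>, \<open>lo y\<close> and \<open>up y\<close> are the ends of \<open>y\<close> farther from
  and nearer to the root (in either order if they are equally far), and \<open>sp v\<close> is the special
  edge of \<open>v\<close>. A labelling consists of \<open>a y\<close> for the half at \<open>lo y\<close> and \<open>b y\<close> for the half at \<open>up y\<close>.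
\<close>

locale levelled_multigraph =
  fixes X :: "'a set" and Y :: "'b set" and lo up :: "'b \<Rightarrow> 'a"
    and d :: "'a \<Rightarrow> nat" and r :: 'a and sp :: "'a \<Rightarrow> 'b" and k :: nat
  assumes finite_X: "finite X" and finite_Y: "finite Y"
    and ends: "y \<in> Y \<Longrightarrow> lo y \<in> X \<and> up y \<in> X \<and> lo y \<noteq> up y"
    and levels: "y \<in> Y \<Longrightarrow> d (lo y) = d (up y) \<or> d (lo y) = Suc (d (up y))"
    and root: "r \<in> X" "d r = 0" "\<lbrakk>v \<in> X; d v = 0\<rbrakk> \<Longrightarrow> v = r"
    and sp: "\<lbrakk>v \<in> X; v \<noteq> r\<rbrakk> \<Longrightarrow> sp v \<in> Y \<and> lo (sp v) = v \<and> d (up (sp v)) < d v"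
    and regular: "v \<in> X \<Longrightarrow> card {y \<in> Y. lo y = v} + card {y \<in> Y. up y = v} = k"
    and k_ge: "4 \<le> k" and k_even: "even k"
begin

definition level :: "nat \<Rightarrow> 'a set" where
  "level l = {v \<in> X. d v = l}"

text \<open>An edge is labelled together with its end farther from the root, so these are the edges
  that carry labels once level \<open>l\<close> is done.\<close>

definition below :: "nat \<Rightarrow> 'b set" where
  "below l = {y \<in> Y. l \<le> d (lo y)}"

definition ordinary :: "nat \<Rightarrow> 'b set" where
  "ordinary l = {y \<in> Y. d (lo y) = l \<and> d (up y) < l} - sp ` level l"

definition vsum :: "('b \<Rightarrow> nat) \<Rightarrow> ('b \<Rightarrow> nat) \<Rightarrow> 'b set \<Rightarrow> 'a \<Rightarrow> nat" where
  "vsum a b B v = (\<Sum>y | y \<in> B \<and> lo y = v. a y) + (\<Sum>y | y \<in> B \<and> up y = v. b y)"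

text \<open>
  The number \<open>c\<close> separates levels: a vertex of level \<open>l\<close> has only its special label above \<open>c\<close>,
  whereas all labels at the vertices nearer to the root exceed \<open>c\<close>. The last
  conjunct is only needed for the root, which must see a label as large as that of any special half.
\<close>

definition level_labelling :: "nat \<Rightarrow> ('b \<Rightarrow> nat) \<Rightarrow> ('b \<Rightarrow> nat) \<Rightarrow> nat \<Rightarrow> bool" where
  "level_labelling l a b c \<longleftrightarrow>
     odd_labelling a b 0 (below l) \<and>
     c + card (ordinary l) + 2 * card (level l) = 2 * card (below l) \<and>
     (\<forall>y\<in>below l. d (up y) < l \<longrightarrow> c < b y) \<and>
     (\<forall>v\<in>X. l \<le> d v \<longrightarrow> even (vsum a b (below l) v) \<and>
        vsum a b (below l) v \<le> (k - 1) * c + 2 * card (below l)) \<and>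
     inj_on (vsum a b (below l)) {v \<in> X. l \<le> d v} \<and>
     (odd (card (ordinary l)) \<or> 2 \<le> card (level l) \<longrightarrow>
        (\<exists>y\<in>below l. d (up y) < l \<and> 2 * card (below l) - 1 \<le> b y))"

section \<open>Bounds on vertex sums\<close>

lemma vsum_upper:
  assumes "card {y \<in> B. lo y = v} + card {y \<in> B. up y = v} = n"
    and "\<And>y. \<lbrakk>y \<in> B; lo y = v\<rbrakk> \<Longrightarrow> a y \<le> c" "\<And>y. \<lbrakk>y \<in> B; up y = v\<rbrakk> \<Longrightarrow> b y \<le> c"
  shows "vsum a b B v \<le> n * c"
proof -
  have "(\<Sum>y | y \<in> B \<and> lo y = v. a y) \<le> card {y \<in> B. lo y = v} * c"
    using sum_bounded_above[of "{y \<in> B. lo y = v}" a c] assms(2) by simp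
  moreover have "(\<Sum>y | y \<in> B \<and> up y = v. b y) \<le> card {y \<in> B. up y = v} * c"
    using sum_bounded_above[of "{y \<in> B. up y = v}" b c] assms(3) by simp
  ultimately show ?thesis
    unfolding vsum_def assms(1)[symmetric] add_mult_distrib by linarith
qed

lemma vsum_lower:
  assumes "card {y \<in> B. lo y = v} + card {y \<in> B. up y = v} = n"
    and "\<And>y. \<lbrakk>y \<in> B; lo y = v\<rbrakk> \<Longrightarrow> c \<le> a y" "\<And>y. \<lbrakk>y \<in> B; up y = v\<rbrakk> \<Longrightarrow> c \<le> b y"
  shows "n * c \<le> vsum a b B v"
proof -
  have "card {y \<in> B. lo y = v} * c \<le> (\<Sum>y | y \<in> B \<and> lo y = v. a y)"
    using sum_bounded_below[of "{y \<in> B. lo y = v}" c a] assms(2) by simp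
  moreover have "card {y \<in> B. up y = v} * c \<le> (\<Sum>y | y \<in> B \<and> up y = v. b y)"
    using sum_bounded_below[of "{y \<in> B. up y = v}" c b] assms(3) by simp
  ultimately show ?thesis
    unfolding vsum_def assms(1)[symmetric] add_mult_distrib by linarith
qed

section \<open>The induction from the farthest level towards the root\<close>

lemma level_labelling_empty:
  assumes "\<And>v. v \<in> X \<Longrightarrow> d v < l"
  shows "level_labelling l (\<lambda>_. 0) (\<lambda>_. 0) 0"
proof -
  have none: "\<not> l \<le> d v" "d v \<noteq> l" if "v \<in> X" for v
    using assms[OF that] by simp_all
  have "below l = {}" "level l = {}" "ordinary l = {}"
    using none ends by (auto simp: below_def level_def ordinary_def)
  moreover have "{v \<in> X. l \<le> d v} = {}"
    using none by auto
  ultimately show ?thesis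
    unfolding level_labelling_def using none(1) by (simp only:) (auto simp: odd_labelling_def)
qed

text \<open>Old labels stay, and the edges in \<open>W\<close>, then \<open>P\<close> and
  \<open>S\<close>, use the next ones. Old sums are at most \<open>(k - 1) * c + 2 * card A\<close>.
  At a vertex of level \<open>l\<close>, \<open>k - 1\<close> labels exceed \<open>c\<close> and the
  special one exceeds \<open>2 * card A\<close>, so new sums are larger than all old ones.\<close>

lemma level_labelling_step:
  assumes IH: "level_labelling (Suc l) a b c" and l: "0 < l"
  shows "\<exists>a' b' c'. level_labelling l a' b' c'"
proof -
  define A where "A = below (Suc l)"
  define L where "L = level l"
  define W where "W = {y \<in> Y. d (lo y) = l \<and> d (up y) = l}"
  define S where "S = sp ` L"
  define P where "P = ordinary l"
  define R where "R = A \<union> (W \<union> P)"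
  have lab: "odd_labelling a b 0 A"
    and c_eq: "c + card (ordinary (Suc l)) + 2 * card (level (Suc l)) = 2 * card A"
    and up_gt: "\<And>y. \<lbrakk>y \<in> A; d (up y) < Suc l\<rbrakk> \<Longrightarrow> c < b y"
    and old: "\<And>v. \<lbrakk>v \<in> X; Suc l \<le> d v\<rbrakk> \<Longrightarrow> even (vsum a b A v) \<and> vsum a b A v \<le> (k - 1) * c + 2 * card A"
    and old_inj: "inj_on (vsum a b A) {v \<in> X. Suc l \<le> d v}"
    using IH by (simp_all add: level_labelling_def A_def)
  have spL: "sp v \<in> Y" "lo (sp v) = v" "d (up (sp v)) < l" "d v = l" "v \<in> X" if "v \<in> L" for v
  proof -
    show v: "d v = l" "v \<in> X"
      using that by (auto simp: L_def level_def)
    then have "v \<noteq> r"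
      using root(2) l by auto
    with sp[OF v(2)] v(1) show "sp v \<in> Y" "lo (sp v) = v" "d (up (sp v)) < l"
      by auto
  qed
  have inj_sp: "inj_on sp L"
    using spL(2) by (metis inj_onI)
  have card_S: "card S = card L"
    using inj_sp by (simp add: S_def card_image)
  have SD: "y \<in> Y" "lo y \<in> L" "sp (lo y) = y" "d (lo y) = l" "d (up y) < l" if "y \<in> S" for y
    using that spL by (auto simp: S_def)
  have PD: "y \<in> Y" "lo y \<in> L" "d (lo y) = l" "d (up y) < l" "y \<notin> S" if "y \<in> P" for y
    using that ends by (auto simp: P_def ordinary_def S_def L_def level_def)
  have AD: "y \<in> Y" "Suc l \<le> d (lo y)" if "y \<in> A" for y
    using that by (auto simp: A_def below_def)
  have WD: "y \<in> Y" "d (lo y) = l" "d (up y) = l" if "y \<in> W" for y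
    using that by (auto simp: W_def)
  have fin: "finite A" "finite W" "finite P" "finite S" "finite L"
    using finite_Y finite_X by (auto simp: A_def below_def W_def P_def ordinary_def S_def L_def level_def)
  have disj: "A \<inter> (W \<union> (P \<union> S)) = {}" "W \<inter> (P \<union> S) = {}" "P \<inter> S = {}"
  proof -
    have "False" if "y \<in> A" "y \<in> W \<union> (P \<union> S)" for y
      using AD(2)[of y] WD(2)[of y] PD(3)[of y] SD(4)[of y] that by auto
    then show "A \<inter> (W \<union> (P \<union> S)) = {}" by blast
    have "False" if "y \<in> W" "y \<in> P \<union> S" for y
      using WD(3)[of y] PD(4)[of y] SD(5)[of y] that by auto
    then show "W \<inter> (P \<union> S) = {}" by blast
    show "P \<inter> S = {}"
      using PD(5) by blast
  qed
  have below: "below l = A \<union> (W \<union> (P \<union> S))"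
  proof (intro equalityI subsetI)
    fix y assume "y \<in> below l"
    then have "y \<in> Y" "l \<le> d (lo y)"
      by (auto simp: below_def)
    then consider "Suc l \<le> d (lo y)" | "d (lo y) = l" "d (up y) = l" | "d (lo y) = l" "d (up y) < l"
      using levels[of y] by linarith
    then show "y \<in> A \<union> (W \<union> (P \<union> S))"
      using \<open>y \<in> Y\<close>
      by cases (auto simp: below_def A_def W_def P_def ordinary_def S_def L_def)
  next
    fix y assume "y \<in> A \<union> (W \<union> (P \<union> S))"
    then show "y \<in> below l"
      using SD(1,4)[of y] PD(1,3)[of y] AD[of y] WD(1,2)[of y] by (auto simp: below_def)
  qed
  have card_below: "card (below l) = card A + card W + card P + card L"
    using fin disj by (simp add: below card_Un_disjoint card_S)
  obtain iW where iW: "bij_betw iW W {..<card W}"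
    using ex_monotone_ranking[OF fin(2)] by blast
  obtain iP where iP: "bij_betw iP P {..<card P}"
    using ex_monotone_ranking[OF fin(3)] by blast
  define m where "m = 2 * card A + 2 * card W"
  define q where "q = card P"
  \<comment> \<open>The labels outside \<open>S\<close> are fixed first, since the order and the
    orientation of the special pairs depend on the partial sums \<open>wt\<close>. On
    \<open>S\<close> the last branch is a default that \<open>a'\<close> and \<open>b'\<close>
    overwrite.\<close>
  define a1 where "a1 y = (if y \<in> A then a y else if y \<in> W then 2 * card A + 2 * iW y + 1
      else m + iP y + 1)" for y
  define b1 where "b1 y = (if y \<in> A then b y else if y \<in> W then 2 * card A + 2 * iW y + 2
      else m + split_high q (iP y))" for y
  define wt where "wt v = vsum a1 b1 R v" for v
  obtain j where j: "bij_betw j L {..<card L}"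
    and j_mono: "\<And>u v. \<lbrakk>u \<in> L; v \<in> L; j u < j v\<rbrakk> \<Longrightarrow> wt u \<le> wt v"
    using ex_monotone_ranking[OF fin(5), of wt] by blast
  \<comment> \<open>As \<open>m\<close> is even, \<open>pair_low\<close> gives an odd and
    \<open>pair_high\<close> an even label. The half at \<open>lo y\<close> takes the one with the
    parity of the partial sum, which makes the full sum even.\<close>
  define a' where "a' y = (if y \<in> S then m + (if odd (wt (lo y)) then pair_low q (j (lo y))
      else pair_high q (j (lo y))) else a1 y)" for y
  define b' where "b' y = (if y \<in> S then m + (if odd (wt (lo y)) then pair_high q (j (lo y))
      else pair_low q (j (lo y))) else b1 y)" for y
  have onR: "a' y = a1 y" "b' y = b1 y" if "y \<in> R" for y
    using that disj by (auto simp: a'_def b'_def R_def)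
  have onA: "a' y = a y" "b' y = b y" if "y \<in> A" for y
    using that disj by (auto simp: a'_def b'_def a1_def b1_def)
  have onW: "a' y = 2 * card A + 2 * iW y + 1" "b' y = 2 * card A + 2 * iW y + 2" if "y \<in> W" for y
    using that disj by (auto simp: a'_def b'_def a1_def b1_def)
  have onP: "a' y = m + iP y + 1" "b' y = m + split_high q (iP y)" if "y \<in> P" for y
    using that disj by (auto simp: a'_def b'_def a1_def b1_def)
  have bij_S: "bij_betw (\<lambda>y. j (lo y)) S {..<card S}"
  proof -
    have "bij_betw lo S L"
      by (rule bij_betw_byWitness[where f' = sp]) (use SD spL in \<open>auto simp: S_def\<close>)
    from bij_betw_trans[OF this j] show ?thesis
      by (simp add: comp_def card_S)
  qed
  have lab_W: "odd_labelling a' b' (2 * card A) W"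
    by (rule odd_labelling_consecutive_pairs[OF iW]) (simp add: onW)
  have lab_PS: "odd_labelling a' b' m (P \<union> S)"
  proof (rule odd_labelling_split[OF iP bij_S fin(3,4) disj(3)])
    show "S \<noteq> {}" if "P \<noteq> {}"
      using PD(2) that by (auto simp: S_def)
    fix y assume "y \<in> S"
    then show "a' y = m + pair_low (card P) (j (lo y)) \<and> b' y = m + pair_high (card P) (j (lo y)) \<or>
        a' y = m + pair_high (card P) (j (lo y)) \<and> b' y = m + pair_low (card P) (j (lo y))"
      by (simp add: a'_def b'_def q_def)
  qed (simp add: onP q_def)
  have lab_A: "odd_labelling a' b' 0 A"
    by (rule odd_labelling_cong[OF lab]) (simp add: onA)
  have lab': "odd_labelling a' b' 0 (below l)"
  proof -
    have "odd_labelling a' b' (2 * card A) (W \<union> (P \<union> S))"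
      by (rule odd_labelling_Un[OF lab_W]) (use lab_PS fin disj in \<open>simp_all add: m_def\<close>)
    then show ?thesis
      unfolding below by (intro odd_labelling_Un[OF lab_A]) (use fin disj in simp_all)
  qed
  \<comment> \<open>Every edge at a vertex of distance at least \<open>l\<close> already belongs to
    \<open>below l\<close>, so the sums formed here are final.\<close>
  have below_lo: "{y \<in> Y. lo y = v} = {y \<in> below l. lo y = v}" if "l \<le> d v" for v
    using that by (auto simp: below_def)
  have below_up: "{y \<in> Y. up y = v} = {y \<in> below l. up y = v}" if "l \<le> d v" for v
  proof -
    have "l \<le> d (lo y)" if "y \<in> Y" "up y = v" for y
      using levels[OF that(1)] that(2) \<open>l \<le> d v\<close> by auto
    then show ?thesis
      by (auto simp: below_def)
  qed
  \<comment> \<open>The upper end of a special edge of this level lies nearer to the root, so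
    \<open>sp v\<close> is the only member of \<open>S\<close> that meets \<open>v\<close>.\<close>
  have L_lo: "{y \<in> below l. lo y = v} = insert (sp v) {y \<in> R. lo y = v}"
    and L_up: "{y \<in> below l. up y = v} = {y \<in> R. up y = v}"
    and L_notin: "sp v \<notin> R" if "v \<in> L" for v
  proof -
    have "sp v \<in> S" using that by (simp add: S_def)
    then show "sp v \<notin> R" using disj by (auto simp: R_def)
    show "{y \<in> below l. lo y = v} = insert (sp v) {y \<in> R. lo y = v}"
      using \<open>sp v \<in> S\<close> SD(3) spL[OF that] by (auto simp: below R_def)
    show "{y \<in> below l. up y = v} = {y \<in> R. up y = v}"
      using SD(5) spL(4)[OF that] by (auto simp: below R_def)
  qed
  have fin_R: "finite R"
    using fin by (simp add: R_def)
  have cardR: "card {y \<in> R. lo y = v} + card {y \<in> R. up y = v} = k - 1" if "v \<in> L" for v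
  proof -
    have "card {y \<in> below l. lo y = v} = Suc (card {y \<in> R. lo y = v})"
      unfolding L_lo[OF that] using fin_R L_notin[OF that] by simp
    then show ?thesis
      using regular[OF spL(5)[OF that]] below_lo[of v] below_up[of v] L_up[OF that] spL(4)[OF that]
      by simp
  qed
  have new: "vsum a' b' (below l) v = wt v + a' (sp v)" if "v \<in> L" for v
  proof -
    have "(\<Sum>y | y \<in> R \<and> lo y = v. a' y) = (\<Sum>y | y \<in> R \<and> lo y = v. a1 y)"
      "(\<Sum>y | y \<in> R \<and> up y = v. b' y) = (\<Sum>y | y \<in> R \<and> up y = v. b1 y)"
      by (rule sum.cong; simp add: onR)+
    then show ?thesis
      unfolding vsum_def wt_def L_lo[OF that] L_up[OF that] using fin_R L_notin[OF that] by simp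
  qed
  have same: "vsum a' b' (below l) v = vsum a b A v" if "v \<in> X" "Suc l \<le> d v" for v
  proof -
    have "d (lo y) \<le> l" "d (up y) \<le> l" if "y \<in> W \<union> (P \<union> S)" for y
      using SD(4,5)[of y] PD(3,4)[of y] WD(2,3)[of y] that by auto
    then have "lo y \<noteq> v" "up y \<noteq> v" if "y \<in> W \<union> (P \<union> S)" for y
      using that \<open>Suc l \<le> d v\<close> by force+
    then have "{y \<in> below l. lo y = v} = {y \<in> A. lo y = v}"
      "{y \<in> below l. up y = v} = {y \<in> A. up y = v}"
      unfolding below by blast+
    moreover have "sum a' {y \<in> A. lo y = v} = sum a {y \<in> A. lo y = v}"
      "sum b' {y \<in> A. up y = v} = sum b {y \<in> A. up y = v}"
      by (rule sum.cong; simp add: onA)+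
    ultimately show ?thesis
      by (simp add: vsum_def)
  qed
  have iW_less: "iW y < card W" if "y \<in> W" for y
    using iW that by (auto dest: bij_betwE)
  have iP_less: "iP y < q" if "y \<in> P" for y
    using iP that by (auto simp: q_def dest: bij_betwE)
  have c_le: "c \<le> 2 * card A"
    using c_eq by linarith
  \<comment> \<open>Edges of \<open>P\<close> meet \<open>L\<close> only in their lower halves,
    which carry the labels \<open>m + 1\<close> to \<open>m + q\<close>. This is why these halves
    come before the upper ones.\<close>
  have lo_bds: "c < a1 y \<and> a1 y \<le> m + q" if "y \<in> R" "lo y = v" "v \<in> L" for y v
  proof -
    have "y \<in> W \<or> y \<in> P"
      using that AD(2)[of y] spL(4)[of v] by (auto simp: R_def)
    then show ?thesis
      using onR[OF that(1)] onW[of y] onP[of y] iW_less[of y] iP_less[of y] c_le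
      by (auto simp: m_def)
  qed
  \<comment> \<open>An upper half at \<open>v\<close> belongs to an edge inside the level or to one
    from level \<open>Suc l\<close>. For the latter the lower bound is the separation property of
    the old labelling.\<close>
  have up_bds: "c < b1 y \<and> b1 y \<le> m + q" if "y \<in> R" "up y = v" "v \<in> L" for y v
  proof -
    have "y \<in> W \<or> y \<in> A"
      using that PD(4)[of y] spL(4)[of v] by (auto simp: R_def)
    then show ?thesis
      using onR[OF that(1)] onW[of y] onA[of y] iW_less[of y] c_le up_gt[of y] that
        odd_labelling_bounds(4)[OF lab, of y] spL(4)[of v]
      by (auto simp: m_def)
  qed
  have wt_le: "wt v \<le> (k - 1) * (m + q)" if "v \<in> L" for v
    unfolding wt_def by (rule vsum_upper[OF cardR[OF that]]) (use lo_bds up_bds that in auto)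
  have wt_ge: "(k - 1) * Suc c \<le> wt v" if "v \<in> L" for v
    unfolding wt_def by (rule vsum_lower[OF cardR[OF that]]) (use lo_bds up_bds that in \<open>auto simp: Suc_le_eq\<close>)
  have sp_S: "sp v \<in> S" if "v \<in> L" for v
    using that by (simp add: S_def)
  have s_gt: "m < a' (sp v)" if "v \<in> L" for v
    using odd_labelling_bounds(1)[OF lab_PS] sp_S[OF that] by blast
  have s_le: "a' (sp v) \<le> 2 * card (below l)" if "v \<in> L" for v
    using odd_labelling_bounds(2)[OF lab'] sp_S[OF that] by (simp add: below)
  have new_even: "even (vsum a' b' (below l) v)" if "v \<in> L" for v
    using sp_S[OF that] spL(2)[OF that] odd_pair_low even_pair_high
    by (auto simp: new[OF that] a'_def m_def)
  \<comment> \<open>Partial sums may tie; strictness comes from the special labels, which increase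
    with the rank whichever way the pairs are oriented.\<close>
  have new_mono: "vsum a' b' (below l) u < vsum a' b' (below l) v"
    if "u \<in> L" "v \<in> L" "j u < j v" for u v
  proof -
    have "a' (sp u) < a' (sp v)"
      using sp_S[OF that(1)] sp_S[OF that(2)] spL(2)[OF that(1)] spL(2)[OF that(2)]
        pair_high_less_low[OF that(3), of q] pair_low_less_high[of q "j u"] pair_low_less_high[of q "j v"]
      by (auto simp: a'_def)
    then show ?thesis
      using j_mono[OF that] by (simp add: new that)
  qed
  have old_less_new: "vsum a' b' (below l) u < vsum a' b' (below l) v"
    if "u \<in> X" "Suc l \<le> d u" "v \<in> L" for u v
  proof -
    have "(k - 1) * c \<le> (k - 1) * Suc c" by simp
    then show ?thesis
      using old[OF that(1,2)] wt_ge[OF that(3)] s_gt[OF that(3)]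
      unfolding same[OF that(1,2)] new[OF that(3)] m_def by linarith
  qed
  have cases: "v \<in> L \<or> Suc l \<le> d v" if "v \<in> X" "l \<le> d v" for v
    using that by (auto simp: L_def level_def)
  have "inj_on (vsum a' b' (below l)) {v \<in> X. l \<le> d v}"
  proof (rule inj_onI, clarsimp)
    fix u v
    assume uv: "u \<in> X" "l \<le> d u" "v \<in> X" "l \<le> d v" "vsum a' b' (below l) u = vsum a' b' (below l) v"
    consider "u \<in> L" "v \<in> L" | "Suc l \<le> d u" "Suc l \<le> d v" | "u \<in> L" "Suc l \<le> d v" | "Suc l \<le> d u" "v \<in> L"
      using uv cases by blast
    then show "u = v"
    proof cases
      case 1
      then have "j u = j v"
        using new_mono[of u v] new_mono[of v u] uv(5) by (metis linorder_neqE_nat less_irrefl)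
      then show ?thesis
        using 1 j by (meson bij_betw_imp_inj_on inj_onD)
    next
      case 2
      then show ?thesis
        using old_inj uv same by (auto dest: inj_onD)
    next
      case 3
      then show ?thesis using old_less_new[of v u] uv by simp
    next
      case 4
      then show ?thesis using old_less_new[of u v] uv by simp
    qed
  qed
  moreover have "even (vsum a' b' (below l) v) \<and>
      vsum a' b' (below l) v \<le> (k - 1) * (m + q) + 2 * card (below l)" if "v \<in> X" "l \<le> d v" for v
    using cases[OF that]
  proof
    assume "v \<in> L"
    then show ?thesis
      using new_even[of v] wt_le[of v] s_le[of v] by (simp add: new)
  next
    assume v: "Suc l \<le> d v"
    have "(k - 1) * c \<le> (k - 1) * (m + q)"
      using c_le by (intro mult_le_mono2) (simp add: m_def)
    moreover have "2 * card A \<le> 2 * card (below l)"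
      by (simp add: card_below)
    moreover note old[OF that(1) v]
    ultimately show ?thesis
      unfolding same[OF that(1) v] by linarith
  qed
  \<comment> \<open>Every offset handed to a nearer level is at least \<open>q + 1\<close>,
    including the skipped one given to the first special edge. Hence \<open>m + q\<close> serves as
    the new \<open>c\<close>.\<close>
  moreover have "m + q < b' y" if "y \<in> below l" "d (up y) < l" for y
  proof -
    have "y \<in> P \<or> y \<in> S"
      using that AD(1,2)[of y] WD(3)[of y] levels[of y] by (auto simp: below)
    then show ?thesis
      using onP[of y] by (auto simp: b'_def split_label_defs)
  qed
  moreover have "\<exists>y\<in>below l. d (up y) < l \<and> 2 * card (below l) - 1 \<le> b' y"
    if "odd (card (ordinary l)) \<or> 2 \<le> card (level l)"
  proof -
    have *: "odd q \<or> 2 \<le> card L"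
      using that by (simp add: q_def L_def P_def)
    have "P \<noteq> {}" if "odd q"
      using that by (auto simp: q_def)
    then have "L \<noteq> {}"
      using * PD(2) by auto
    then have pos: "0 < card L"
      using fin by (simp add: card_gt_0_iff)
    then have "card L - 1 \<in> j ` L"
      using j by (simp add: bij_betw_def)
    then obtain v where v: "v \<in> L" "j v = card L - 1"
      by auto
    have "m + pair_low q (card L - 1) \<le> b' (sp v)"
      using sp_S[OF v(1)] spL(2)[OF v(1)] v(2) pair_low_less_high[of q "card L - 1"]
      by (simp add: b'_def)
    \<comment> \<open>The last special pair consists of the two largest labels unless
      \<open>q\<close> is even and the pair is also the first one, in which case its low offset is
      \<open>q + 1\<close>. The premise rules this out.\<close>
    moreover have "m + pair_low q (card L - 1) = 2 * card (below l) - 1"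
      using * pos by (auto simp: pair_low_def card_below m_def q_def)
    moreover have "sp v \<in> below l"
      using sp_S[OF v(1)] by (simp add: below)
    ultimately show ?thesis
      using spL(3)[OF v(1)] by (intro bexI[of _ "sp v"]) auto
  qed
  moreover have "m + q + card (ordinary l) + 2 * card (level l) = 2 * card (below l)"
    by (simp add: card_below m_def q_def P_def L_def)
  ultimately have "level_labelling l a' b' (m + q)"
    using lab' unfolding level_labelling_def by blast
  then show ?thesis by blast
qed

text \<open>Downward induction from beyond the farthest level. It stops at level 1 because the root
  has no special edge.\<close>

lemma ex_level_labelling: "\<exists>a b c. level_labelling 1 a b c"
proof -
  define D where "D = Max (d ` X)"
  have D: "d v < Suc D" if "v \<in> X" for v
    using that finite_X by (simp add: D_def less_Suc_eq_le)
  have "1 \<le> Suc D" by simp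
  then show ?thesis
  proof (induction rule: inc_induct)
    case base
    then show ?case using level_labelling_empty[of "Suc D"] D by blast
  next
    case (step l)
    then show ?case using level_labelling_step[of l] by auto
  qed
qed

section \<open>Counting edges and separating the root\<close>

lemma card_edges: "2 * card Y = k * card X"
proof -
  have "(\<Sum>v\<in>X. card {y \<in> Y. lo y = v}) = card Y"
    using sum.group[OF finite_Y finite_X, of lo "\<lambda>_. 1::nat"] ends by auto
  moreover have "(\<Sum>v\<in>X. card {y \<in> Y. up y = v}) = card Y"
    using sum.group[OF finite_Y finite_X, of up "\<lambda>_. 1::nat"] ends by auto
  ultimately have "2 * card Y = (\<Sum>v\<in>X. card {y \<in> Y. lo y = v} + card {y \<in> Y. up y = v})"
    by (simp add: sum.distrib)
  also have "\<dots> = k * card X"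
    by (simp add: regular)
  finally show ?thesis .
qed

text \<open>The root meets \<open>k\<close> upper halves, all with labels above \<open>c\<close> and
  one with label at least \<open>2 * N - 1\<close>. This beats the bound
  \<open>(k - 1) * c + 2 * N\<close> on the other sums by \<open>k - 2\<close> or more, and
  \<open>root_sum_bound\<close> lifts it to \<open>4 * N\<close>.\<close>

lemma ex_separating_labelling:
  "\<exists>a b. odd_labelling a b 0 Y \<and> inj_on (vsum a b Y) X \<and>
     (\<forall>v\<in>X. \<forall>y\<in>Y. vsum a b Y v \<noteq> a y + b y)"
proof -
  obtain a b c where lab: "level_labelling 1 a b c"
    using ex_level_labelling by blast
  \<comment> \<open>If the root were a lower end, the upper end would also be at distance 0 and
    hence equal to the root.\<close>
  have "lo y \<noteq> r" if "y \<in> Y" for y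
    using ends[OF that] levels[OF that] root(2) root(3)[of "up y"] by auto
  then have lo_pos: "0 < d (lo y)" if "y \<in> Y" for y
    using that ends root(3) by blast
  then have Y: "below 1 = Y"
    by (auto simp: below_def Suc_le_eq)
  define N where "N = card Y"
  define p where "p = card (level 1)"
  define q where "q = card (ordinary 1)"
  have odd: "odd_labelling a b 0 Y"
    and c: "c + q + 2 * p = 2 * N"
    and up_gt: "\<And>y. \<lbrakk>y \<in> Y; d (up y) = 0\<rbrakk> \<Longrightarrow> c < b y"
    and nonroot: "\<And>v. \<lbrakk>v \<in> X; 0 < d v\<rbrakk> \<Longrightarrow> even (vsum a b Y v) \<and> vsum a b Y v \<le> (k - 1) * c + 2 * N"
    and inj: "inj_on (vsum a b Y) {v \<in> X. 0 < d v}"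
    and top: "odd q \<or> 2 \<le> p \<Longrightarrow> \<exists>y\<in>Y. d (up y) = 0 \<and> 2 * N - 1 \<le> b y"
    using lab unfolding level_labelling_def Y by (simp_all add: Suc_le_eq N_def p_def q_def)
  define Z where "Z = {y \<in> Y. up y = r}"
  have fin_Z: "finite Z" using finite_Y by (simp add: Z_def)
  have root_lo: "{y \<in> Y. lo y = r} = {}"
    using lo_pos root(2) by fastforce
  have card_Z: "card Z = k"
    using regular[OF root(1)] unfolding root_lo by (simp add: Z_def)
  have sp1: "sp v \<in> Y" "lo (sp v) = v" "d (up (sp v)) = 0" "v \<noteq> r" if "v \<in> level 1" for v
  proof -
    have v: "v \<in> X" "d v = 1"
      using that by (auto simp: level_def)
    then show "v \<noteq> r"
      using root(2) by auto
    with sp[OF v(1)] v(2) show "sp v \<in> Y" "lo (sp v) = v" "d (up (sp v)) = 0"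
      by auto
  qed
  have "Z = ordinary 1 \<union> sp ` level 1"
  proof (intro equalityI subsetI)
    fix y assume "y \<in> Z"
    then show "y \<in> ordinary 1 \<union> sp ` level 1"
      using levels[of y] lo_pos[of y] root(2) by (auto simp: Z_def ordinary_def)
  next
    fix y assume "y \<in> ordinary 1 \<union> sp ` level 1"
    then have "y \<in> Y" "d (up y) = 0"
      using sp1 by (auto simp: ordinary_def)
    then show "y \<in> Z"
      using ends root(3) by (simp add: Z_def)
  qed
  moreover have "card (sp ` level 1) = p"
    using sp1(2) unfolding p_def by (metis card_image inj_onI)
  moreover have "ordinary 1 \<inter> sp ` level 1 = {}"
    by (auto simp: ordinary_def)
  ultimately have pq: "p + q = k"
    using card_Z fin_Z by (simp add: card_Un_disjoint q_def)
  have fin_level: "finite (level 1)"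
    using finite_X by (simp add: level_def)
  have "p \<noteq> 0"
  proof
    assume "p = 0"
    then have "level 1 = {}"
      using fin_level by (simp add: p_def)
    moreover obtain y where "y \<in> Z"
      using card_Z k_ge by fastforce
    ultimately show False
      using levels[of y] lo_pos[of y] root(2) ends[of y] by (auto simp: Z_def level_def)
  qed
  then have p: "0 < p" by simp
  have "card (insert r (level 1)) \<le> card X"
    using finite_X root(1) by (intro card_mono) (auto simp: level_def)
  then have "1 + p \<le> card X"
    using fin_level root(2) by (simp add: p_def level_def)
  then have "k * (1 + p) \<le> 2 * N"
    unfolding N_def card_edges by (rule mult_le_mono2)
  from root_sum_bound[OF k_ge p pq c this] have bound: "2 * N + 1 \<le> (k - 1) * Suc c" .
  \<comment> \<open>Here the evenness of \<open>k\<close> enters: for \<open>p = 1\<close> the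
    number \<open>q = k - 1\<close> is odd.\<close>
  have "odd q \<or> 2 \<le> p"
    using pq p k_even by (cases "p = 1") auto
  from top[OF this] obtain z where z: "z \<in> Z" "2 * N - 1 \<le> b z"
    using ends root(3) by (auto simp: Z_def)
  have "(k - 1) * Suc c \<le> (\<Sum>y\<in>Z - {z}. b y)"
    using sum_bounded_below[of "Z - {z}" "Suc c" b] up_gt root(2) card_Z fin_Z z(1)
    by (auto simp: Z_def Suc_le_eq)
  then have "2 * N - 1 + (k - 1) * Suc c \<le> (\<Sum>y\<in>Z. b y)"
    using z fin_Z by (simp add: sum.remove)
  also have "\<dots> = vsum a b Y r"
    unfolding vsum_def root_lo by (simp add: Z_def)
  finally have root_ge: "2 * N - 1 + (k - 1) * Suc c \<le> vsum a b Y r" .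
  have root_gt: "vsum a b Y v < vsum a b Y r" if "v \<in> X" "v \<noteq> r" for v
  proof -
    have "0 < d v" using that root(3) by blast
    moreover have "(k - 1) * Suc c = (k - 1) * c + (k - 1)" by simp
    ultimately show ?thesis
      using nonroot[of v] that root_ge k_ge by linarith
  qed
  have "inj_on (vsum a b Y) X"
  proof (rule inj_onI)
    fix u v assume uv: "u \<in> X" "v \<in> X" "vsum a b Y u = vsum a b Y v"
    then have "u = r \<longleftrightarrow> v = r"
      using root_gt by (metis less_irrefl)
    then show "u = v"
      using uv inj root(3) by (auto dest!: inj_onD)
  qed
  moreover have "vsum a b Y v \<noteq> a y + b y" if "v \<in> X" "y \<in> Y" for v y
  proof (cases "v = r")
    case True
    \<comment> \<open>The two labels are distinct and at most \<open>2 * N\<close>, so they cannot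
      both equal \<open>2 * N\<close>.\<close>
    have "a y + b y < 4 * N"
      using odd_labelling_bounds[OF odd that(2)] odd_labelling_distinct(3)[OF odd that(2,2)]
      by (simp add: N_def)
    moreover have "4 * N \<le> vsum a b Y r"
      using bound root_ge by linarith
    ultimately show ?thesis using True by simp
  next
    case False
    then have "even (vsum a b Y v)"
      using nonroot root(3) that by blast
    then show ?thesis
      using odd_labelling_distinct(5)[OF odd that(2,2)] by metis
  qed
  ultimately show ?thesis
    using odd by blast
qed

end

subsection \<open>From half-edge labellings to antimagic labellings\<close>

lemma bipartite_graphD:
  assumes "bipartite_graph X Y E"
  shows "X \<inter> Y = {}" "finite X" "finite Y" "e \<in> E \<Longrightarrow> \<exists>x\<in>X. \<exists>y\<in>Y. e = {x, y}"
    "\<lbrakk>{u, v} \<in> E; u \<in> X\<rbrakk> \<Longrightarrow> v \<in> Y" "\<lbrakk>{u, v} \<in> E; u \<in> Y\<rbrakk> \<Longrightarrow> v \<in> X"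
proof -
  show disj: "X \<inter> Y = {}" and "finite X" "finite Y"
    using assms by (auto simp: bipartite_graph_def simple_graph_def)
  show cases: "\<exists>x\<in>X. \<exists>y\<in>Y. e = {x, y}" if "e \<in> E" for e
    using assms that by (auto simp: bipartite_graph_def)
  show "v \<in> Y" if "{u, v} \<in> E" "u \<in> X"
    using cases[OF that(1)] that(2) disj by (auto simp: doubleton_eq_iff)
  show "v \<in> X" if "{u, v} \<in> E" "u \<in> Y"
    using cases[OF that(1)] that(2) disj by (auto simp: doubleton_eq_iff)
qed

text \<open>Since each \<open>y\<close> has exactly two neighbours, the edges of \<open>E\<close>
  are the half-edges \<open>(y, t)\<close>, matched by \<open>h\<close>. Labels, sums at
  \<open>Y\<close> and sums at \<open>X\<close> carry over along \<open>h\<close>.\<close>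

lemma antimagicI_separating_labelling:
  fixes X Y :: "'a set" and E :: "'a set set"
  assumes bip: "bipartite_graph X Y E"
    and ends: "\<And>y. y \<in> Y \<Longrightarrow> lo y \<noteq> up y \<and> {v. {y, v} \<in> E} = {lo y, up y}"
    and lab: "odd_labelling a b 0 Y"
    and inj: "inj_on s X"
    and s: "\<And>x. x \<in> X \<Longrightarrow> s x = (\<Sum>y | y \<in> Y \<and> lo y = x. a y) + (\<Sum>y | y \<in> Y \<and> up y = x. b y)"
    and sep: "\<And>x y. \<lbrakk>x \<in> X; y \<in> Y\<rbrakk> \<Longrightarrow> s x \<noteq> a y + b y"
  shows "antimagic (X \<union> Y) E"
proof -
  note disj = bipartite_graphD(1)[OF bip] and fin = bipartite_graphD(2,3)[OF bip]
    and E_cases = bipartite_graphD(4)[OF bip]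
    and edge_X = bipartite_graphD(5)[OF bip] and edge_Y = bipartite_graphD(6)[OF bip]
  have ne: "lo y \<noteq> up y" and E_iff: "{y, v} \<in> E \<longleftrightarrow> v = lo y \<or> v = up y" if "y \<in> Y" for y v
    using ends[OF that] by blast+
  have ends_X: "lo y \<in> X" "up y \<in> X" if "y \<in> Y" for y
    using edge_Y[of y] E_iff[OF that] that by blast+
  \<comment> \<open>The description picks the unique end of \<open>e\<close> in \<open>Y\<close>;
    the test on \<open>lo y\<close> then recognises which half \<open>e\<close> is.\<close>
  define f where "f e = (let y = (THE y. y \<in> Y \<inter> e) in if lo y \<in> e then a y else b y)" for e
  have the_y: "(THE z. z \<in> Y \<inter> {y, v}) = y" if "y \<in> Y" "v \<in> X" for y v
    using that disj by (intro the_equality) auto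
  have f_lo: "f {y, lo y} = a y" if "y \<in> Y" for y
    unfolding f_def the_y[OF that ends_X(1)[OF that]] by simp
  have "lo y \<notin> {y, up y}" if "y \<in> Y" for y
    using that ends[of y] ends_X[of y] disj by auto
  then have f_up: "f {y, up y} = b y" if "y \<in> Y" for y
    unfolding f_def the_y[OF that ends_X(2)[OF that]] using that by simp
  define h where "h = (\<lambda>(y, t). {y, if t then lo y else up y})"
  have h_img: "h ` (Y \<times> UNIV) = E"
  proof (intro equalityI subsetI)
    fix e assume "e \<in> h ` (Y \<times> UNIV)"
    then show "e \<in> E"
      using E_iff by (auto simp: h_def)
  next
    fix e assume "e \<in> E"
    then obtain x y where "y \<in> Y" "e = {y, x}"
      using E_cases by (metis insert_commute)
    then have "e = h (y, True) \<or> e = h (y, False)"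
      using E_iff \<open>e \<in> E\<close> by (auto simp: h_def)
    then show "e \<in> h ` (Y \<times> UNIV)"
      using \<open>y \<in> Y\<close> by blast
  qed
  have f_h: "f (h p) = half_label a b p" if "p \<in> Y \<times> UNIV" for p
    using that f_lo f_up by (cases p) (auto simp: h_def half_label_def)
  have inj_half: "inj_on (half_label a b) (Y \<times> UNIV)"
    and img_half: "half_label a b ` (Y \<times> UNIV) \<subseteq> {0<..0 + 2 * card Y}"
    using lab by (simp_all add: odd_labelling_def)
  have inj_fh: "inj_on (f \<circ> h) (Y \<times> UNIV)"
    using inj_half f_h by (auto simp: inj_on_def)
  have card_half: "card (Y \<times> (UNIV :: bool set)) = 2 * card Y"
    by (simp add: card_cartesian_product)
  have "card E = 2 * card Y"
    using card_image[OF inj_on_imageI2[OF inj_fh]] card_half h_img by simp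
  moreover have "f ` E = {1..2 * card Y}"
  proof -
    have "f ` E = half_label a b ` (Y \<times> UNIV)"
      unfolding h_img[symmetric] image_image using f_h by (rule image_cong[OF refl])
    \<comment> \<open>Equality by counting: there are as many distinct labels as elements of the
      block.\<close>
    also have "\<dots> = {0<..0 + 2 * card Y}"
      by (rule card_subset_eq) (use img_half card_image[OF inj_half] card_half in auto)
    finally show ?thesis by auto
  qed
  moreover have "inj_on f E"
    using inj_on_imageI[OF inj_fh] h_img by simp
  ultimately have bij: "bij_betw f E {1..card E}"
    by (simp add: bij_betw_def)
  have sum_Y: "vertex_sum E f y = a y + b y" if "y \<in> Y" for y
    unfolding vertex_sum_def using ends[OF that] f_lo f_up that by simp
  have sum_X: "vertex_sum E f x = s x" if "x \<in> X" for x
  proof -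
    have "{x, y} \<in> E \<longleftrightarrow> y \<in> Y \<and> (lo y = x \<or> up y = x)" for y
    proof -
      have "{x, y} \<in> E \<longleftrightarrow> {y, x} \<in> E"
        by (simp add: insert_commute)
      then show ?thesis
        using edge_X[of x y] that E_iff[of y x] by auto
    qed
    then have "{v. {x, v} \<in> E} = {y \<in> Y. lo y = x} \<union> {y \<in> Y. up y = x}"
      by blast
    moreover have "{y \<in> Y. lo y = x} \<inter> {y \<in> Y. up y = x} = {}"
      using ne[THEN not_sym] by auto
    ultimately have "vertex_sum E f x =
        (\<Sum>y | y \<in> Y \<and> lo y = x. f {x, y}) + (\<Sum>y | y \<in> Y \<and> up y = x. f {x, y})"
      unfolding vertex_sum_def using fin by (simp add: sum.union_disjoint)
    also have "\<dots> = s x"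
      unfolding s[OF that]
      by (intro arg_cong2[where f = "(+)"] sum.cong) (use f_lo f_up in \<open>auto simp: insert_commute\<close>)
    finally show ?thesis .
  qed
  have "inj_on (vertex_sum E f) (X \<union> Y)"
  proof (rule inj_onI)
    fix u v
    assume uv: "u \<in> X \<union> Y" "v \<in> X \<union> Y" "vertex_sum E f u = vertex_sum E f v"
    consider "u \<in> X" "v \<in> X" | "u \<in> Y" "v \<in> Y" | "u \<in> X" "v \<in> Y" | "u \<in> Y" "v \<in> X"
      using uv by blast
    then show "u = v"
    proof cases
      case 1 then show ?thesis using uv(3) inj by (auto simp: sum_X dest: inj_onD)
    next
      case 2 then show ?thesis using uv(3) odd_labelling_distinct(4)[OF lab] sum_Y by metis
    next
      case 3 then show ?thesis using uv(3) sep[of u v] by (simp add: sum_X sum_Y)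
    next
      case 4 then show ?thesis using uv(3) sep[of v u] by (simp add: sum_X sum_Y)
    qed
  qed
  with bij show ?thesis
    unfolding antimagic_def antimagic_labelling_def by blast
qed

text \<open>Take the length of a shortest \<open>R\<close>-walk from \<open>r\<close>. Prolonging
  such a walk by one step gives the third property, removing its last step the fourth.\<close>

lemma ex_distance_function:
  assumes reach: "\<And>x. x \<in> X \<Longrightarrow> (r, x) \<in> R\<^sup>*" and R: "R \<subseteq> X \<times> X"
  obtains d where "d r = (0::nat)" "\<And>x. \<lbrakk>x \<in> X; d x = 0\<rbrakk> \<Longrightarrow> x = r"
    "\<And>x x'. (x, x') \<in> R \<Longrightarrow> d x' \<le> Suc (d x)"
    "\<And>x. \<lbrakk>x \<in> X; x \<noteq> r\<rbrakk> \<Longrightarrow> \<exists>x'. (x', x) \<in> R \<and> d x' < d x"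
proof -
  define d where "d x = (LEAST n. (r, x) \<in> R ^^ n)" for x
  have d_le: "d x \<le> n" if "(r, x) \<in> R ^^ n" for x n
    unfolding d_def using that by (rule Least_le)
  have d: "(r, x) \<in> R ^^ d x" if "x \<in> X" for x
  proof -
    have "\<exists>n. (r, x) \<in> R ^^ n"
      using reach[OF that] by (rule rtrancl_imp_relpow)
    then show ?thesis
      unfolding d_def by (rule LeastI_ex)
  qed
  have "d r = 0"
    using d_le[of r 0] by simp
  moreover have zero: "x = r" if "x \<in> X" "d x = 0" for x
    using d[OF that(1)] that(2) by simp
  moreover have "d x' \<le> Suc (d x)" if xx': "(x, x') \<in> R" for x x'
  proof (rule d_le)
    show "(r, x') \<in> R ^^ Suc (d x)"
      using d[of x] xx' R by auto
  qed
  moreover have "\<exists>x'. (x', x) \<in> R \<and> d x' < d x" if x: "x \<in> X" "x \<noteq> r" for x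
  proof -
    obtain n where n: "d x = Suc n"
      using zero[OF x(1)] x(2) by (cases "d x") auto
    then obtain x' where "(r, x') \<in> R ^^ n" "(x', x) \<in> R"
      using d[OF x(1)] by auto
    then show ?thesis
      using d_le[of x' n] n by auto
  qed
  ultimately show ?thesis by (rule that)
qed

theorem theorem3:
  fixes k :: nat and X Y :: "'a set" and E :: "'a set set"
  assumes "k \<ge> 4" and "even k"
    and "biregular_bipartite k 2 X Y E"
    and "connected_graph (X \<union> Y) E"
  shows "antimagic (X \<union> Y) E"
proof -
  have bip: "bipartite_graph X Y E"
    and deg_X: "\<And>x. x \<in> X \<Longrightarrow> card {v. {x, v} \<in> E} = k"
    and deg_Y: "\<And>y. y \<in> Y \<Longrightarrow> card {v. {y, v} \<in> E} = 2"
    using assms(3) by (auto simp: biregular_bipartite_def degree_def)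
  note disj = bipartite_graphD(1)[OF bip] and fin = bipartite_graphD(2,3)[OF bip]
    and E_cases = bipartite_graphD(4)[OF bip]
    and edge_X = bipartite_graphD(5)[OF bip] and edge_Y = bipartite_graphD(6)[OF bip]
  have "X \<noteq> {}"
  proof
    assume "X = {}"
    then obtain y where "y \<in> Y"
      using assms(4) by (auto simp: connected_graph_def)
    then have "{v. {y, v} \<in> E} \<noteq> {}"
      using deg_Y[of y] by force
    then show False
      using edge_Y[of y] \<open>y \<in> Y\<close> \<open>X = {}\<close> by blast
  qed
  then obtain r where r: "r \<in> X" by blast
  \<comment> \<open>This is adjacency in the multigraph on \<open>X\<close> whose edges are the
    vertices of \<open>Y\<close>; the pairs \<open>(x, x)\<close> it also contains do not affect
    distances.\<close>
  define R where "R = {(x, x'). x \<in> X \<and> x' \<in> X \<and> (\<exists>y\<in>Y. {y, x} \<in> E \<and> {y, x'} \<in> E)}"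
  \<comment> \<open>A walk in \<open>E\<close> alternates between the sides, so for the induction a
    vertex of \<open>Y\<close> has to remember a neighbour already reached in
    \<open>R\<close>.\<close>
  have walk: "(u \<in> X \<longrightarrow> (r, u) \<in> R\<^sup>*) \<and> (u \<in> Y \<longrightarrow> (\<exists>x\<in>X. {y, x} \<in> E \<and> (r, x) \<in> R\<^sup>*))"
    if "(r, u) \<in> {(x, y). {x, y} \<in> E}\<^sup>*" "y = u" for u y
    using that
  proof (induction arbitrary: y rule: rtrancl_induct)
    case base
    then show ?case using r disj by auto
  next
    case (step v w)
    have vw: "{v, w} \<in> E" using step.hyps by simp
    consider "v \<in> X" "w \<in> Y" | "v \<in> Y" "w \<in> X"
      using E_cases[OF vw] by (auto simp: doubleton_eq_iff)
    then show ?case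
    proof cases
      case 1
      then show ?thesis
        using step.IH[OF refl] vw disj step.prems by (auto simp: insert_commute)
    next
      case 2
      then obtain x where x: "x \<in> X" "{v, x} \<in> E" "(r, x) \<in> R\<^sup>*"
        using step.IH[OF refl] by blast
      then have "(x, w) \<in> R"
        using 2 vw by (auto simp: R_def)
      then show ?thesis
        using x 2 disj by (auto intro: rtrancl_into_rtrancl)
    qed
  qed
  have reach: "(r, x) \<in> R\<^sup>*" if "x \<in> X" for x
    using walk[OF _ refl, of x] that r assms(4) by (auto simp: connected_graph_def)
  have "R \<subseteq> X \<times> X" by (auto simp: R_def)
  from ex_distance_function[OF reach this] obtain d :: "'a \<Rightarrow> nat" where
    d_r: "d r = 0" and d_0: "\<And>x. \<lbrakk>x \<in> X; d x = 0\<rbrakk> \<Longrightarrow> x = r"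
    and d_R: "\<And>x x'. (x, x') \<in> R \<Longrightarrow> d x' \<le> Suc (d x)"
    and d_pred: "\<And>x. \<lbrakk>x \<in> X; x \<noteq> r\<rbrakk> \<Longrightarrow> \<exists>x'. (x', x) \<in> R \<and> d x' < d x"
    by blast
  \<comment> \<open>Both neighbours of \<open>y\<close> are related by \<open>R\<close> in either
    direction, so their distances differ by at most one. The pair lists the farther one
    first.\<close>
  have "\<exists>p. fst p \<noteq> snd p \<and> {v. {y, v} \<in> E} = {fst p, snd p} \<and>
      (d (fst p) = d (snd p) \<or> d (fst p) = Suc (d (snd p)))" if y: "y \<in> Y" for y
  proof -
    obtain u v where uv: "{v. {y, v} \<in> E} = {u, v}" "u \<noteq> v"
      using deg_Y[OF y] by (auto simp: card_2_iff)
    then have "(u, v) \<in> R" "(v, u) \<in> R"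
      using y edge_Y[of y] by (auto simp: R_def)
    then have le: "d v \<le> Suc (d u)" "d u \<le> Suc (d v)"
      using d_R by blast+
    show ?thesis
    proof (cases "d v \<le> d u")
      case True
      then show ?thesis using uv le by (intro exI[of _ "(u, v)"]) auto
    next
      case False
      then show ?thesis using uv le by (intro exI[of _ "(v, u)"]) auto
    qed
  qed
  then obtain g where g: "\<And>y. y \<in> Y \<Longrightarrow> fst (g y) \<noteq> snd (g y) \<and> {v. {y, v} \<in> E} = {fst (g y), snd (g y)} \<and>
      (d (fst (g y)) = d (snd (g y)) \<or> d (fst (g y)) = Suc (d (snd (g y))))"
    by metis
  define lo where "lo y = fst (g y)" for y
  define up where "up y = snd (g y)" for y
  have nb: "lo y \<noteq> up y" "{v. {y, v} \<in> E} = {lo y, up y}"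
    and levels: "d (lo y) = d (up y) \<or> d (lo y) = Suc (d (up y))" if "y \<in> Y" for y
    using g[OF that] by (auto simp: lo_def up_def)
  have E_iff: "{y, v} \<in> E \<longleftrightarrow> v = lo y \<or> v = up y" if "y \<in> Y" for y v
    using nb(2)[OF that] by blast
  \<comment> \<open>The last step of a shortest walk to \<open>v\<close> passes through such a
    \<open>y\<close>; as its other neighbour is nearer to the root, \<open>v\<close> must be
    \<open>lo y\<close>.\<close>
  have "\<exists>y. y \<in> Y \<and> lo y = v \<and> d (up y) < d v" if v: "v \<in> X" "v \<noteq> r" for v
  proof -
    obtain x y where xy: "d x < d v" "y \<in> Y" "{y, x} \<in> E" "{y, v} \<in> E"
      using d_pred[OF v] by (auto simp: R_def)
    then have "lo y = v \<and> up y = x"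
      using E_iff[OF xy(2)] levels[OF xy(2)] by auto
    then show ?thesis using xy by blast
  qed
  then obtain sp where sp: "\<And>v. \<lbrakk>v \<in> X; v \<noteq> r\<rbrakk> \<Longrightarrow> sp v \<in> Y \<and> lo (sp v) = v \<and> d (up (sp v)) < d v"
    by metis
  have regular: "card {y \<in> Y. lo y = v} + card {y \<in> Y. up y = v} = k" if "v \<in> X" for v
  proof -
    have "{v, y} \<in> E \<longleftrightarrow> y \<in> Y \<and> (lo y = v \<or> up y = v)" for y
    proof -
      have "{v, y} \<in> E \<longleftrightarrow> {y, v} \<in> E"
        by (simp add: insert_commute)
      then show ?thesis
        using edge_X[of v y] that E_iff[of y v] by auto
    qed
    then have "{u. {v, u} \<in> E} = {y \<in> Y. lo y = v} \<union> {y \<in> Y. up y = v}"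
      by blast
    moreover have "{y \<in> Y. lo y = v} \<inter> {y \<in> Y. up y = v} = {}"
      using nb(1)[THEN not_sym] by auto
    ultimately show ?thesis
      using deg_X[OF that] fin by (simp add: card_Un_disjoint)
  qed
  interpret levelled_multigraph X Y lo up d r sp k
  proof
    show "lo y \<in> X \<and> up y \<in> X \<and> lo y \<noteq> up y" if "y \<in> Y" for y
      using that edge_Y[of y] E_iff[OF that] nb(1) by blast
  qed (fact fin levels r d_r d_0 sp regular assms)+
  obtain a b where ab: "odd_labelling a b 0 Y" "inj_on (vsum a b Y) X"
    "\<forall>v\<in>X. \<forall>y\<in>Y. vsum a b Y v \<noteq> a y + b y"
    using ex_separating_labelling by blast
  show ?thesis
  proof (rule antimagicI_separating_labelling[where lo = lo and up = up and s = "vsum a b Y", OF bip _ ab(1,2)])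
    show "vsum a b Y x = (\<Sum>y | y \<in> Y \<and> lo y = x. a y) + (\<Sum>y | y \<in> Y \<and> up y = x. b y)" for x
      by (rule vsum_def)
    show "lo y \<noteq> up y \<and> {v. {y, v} \<in> E} = {lo y, up y}" if "y \<in> Y" for y
      using nb[OF that] by (rule conjI)
    show "vsum a b Y x \<noteq> a y + b y" if "x \<in> X" "y \<in> Y" for x y
      using ab(3) that by blast
  qed
qed

end
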